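(* Let $X$ and $Y$ be Banach spaces over $\mathbb{K}$ ($\mathbb{K}=\mathbb{R}$ or $\mathbb{C}$). If $T\in\mathcal{L}(X,Y^{**})$ satisfies $T(X)\subseteq Y$ (where $Y$ is canonically embedded in $Y^{**}$) and its adjoint satisfies $T^*\in\mathrm{NA}(Y^{***},X^* )$, then $T\in w^*\mathrm{QNA}(X,Y^{**})$.
   Context: Banach spaces are over $\mathbb{K}=\mathbb{R}$ or $\mathbb{C}$. $B_X$ is the closed unit ball of $X$, $X^*$ its topological dual, and $\mathcal{L}(X,Y)$ the space of bounded linear operators from $X$ to $Y$ with the operator norm. $R\in\mathrm{NA}(E,F)$ ($R\in\mathcal{L}(E,F)$ attains its norm) means there is $e\in B_E$ with $\|Re\|=\|R\|$. An operator $T\in\mathcal{L}(X,Z^* )$ weak-star quasi attains its norm, written $T\in w^*\mathrm{QNA}(X,Z^* )$, if the $\sigma(Z^*,Z)$-closure of $T(B_X)$ intersects the sphere $\{u^*\in Z^*:\|u^*\|=\|T\|\}$. For range space $Y^{**}$, this is applied with $Z=Y^*$, i.e. with the topology $\sigma(Y^{**},Y^* )$. *)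

theory Defs
  imports "HOL-Analysis.Analysis"
begin

text \<open>
  HOL-Analysis provides bounded linear operators over the real field only (\<open>\<Rightarrow>\<^sub>L\<close>).
  The case of complex scalars is treated with a class of complex normed spaces and a type
  \<open>\<Rightarrow>\<^sub>C\<^sub>L\<close> of bounded complex-linear operators, set up in parallel to \<open>\<Rightarrow>\<^sub>L\<close>.  A complex Banach
  space is a type of sort \<open>{complex_normed_vector, banach}\<close>.
\<close>

section \<open>Complex normed spaces and bounded complex-linear operators\<close>

class complex_normed_vector = real_normed_vector +
  fixes scaleC :: "complex \<Rightarrow> 'a \<Rightarrow> 'a"  (infixr \<open>*\<^sub>C\<close> 75)
  assumes scaleC_add_right: "a *\<^sub>C (x + y) = a *\<^sub>C x + a *\<^sub>C y"
    and scaleC_add_left: "(a + b) *\<^sub>C x = a *\<^sub>C x + b *\<^sub>C x"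
    and scaleC_scaleC: "a *\<^sub>C (b *\<^sub>C x) = (a * b) *\<^sub>C x"
    and scaleC_of_real: "complex_of_real r *\<^sub>C x = r *\<^sub>R x"
    and norm_scaleC: "norm (a *\<^sub>C x) = cmod a * norm x"

instantiation complex :: complex_normed_vector
begin

definition scaleC_complex :: "complex \<Rightarrow> complex \<Rightarrow> complex"
  where "scaleC_complex a x = a * x"

instance
  by standard (auto simp: scaleC_complex_def algebra_simps norm_mult scaleR_conv_of_real)

end

lemma bounded_linear_scaleC: "bounded_linear (\<lambda>x::'a::complex_normed_vector. c *\<^sub>C x)"
proof (rule bounded_linear_intro[where K = "cmod c"])
  fix r :: real and x :: 'a
  show "c *\<^sub>C (r *\<^sub>R x) = r *\<^sub>R (c *\<^sub>C x)"
    unfolding scaleC_of_real[symmetric] scaleC_scaleC by (simp add: mult.commute)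
qed (simp_all add: scaleC_add_right norm_scaleC mult.commute)

lemma scaleC_scaleR: "c *\<^sub>C (r *\<^sub>R x) = r *\<^sub>R (c *\<^sub>C (x::'a::complex_normed_vector))"
  using bounded_linear.linear[OF bounded_linear_scaleC] by (rule linear_cmul)

lemma scaleC_minus_right: "c *\<^sub>C (- x) = - (c *\<^sub>C (x::'a::complex_normed_vector))"
  using bounded_linear.linear[OF bounded_linear_scaleC] by (rule linear_neg)

lemma scaleC_diff_right: "c *\<^sub>C (x - y) = c *\<^sub>C x - c *\<^sub>C (y::'a::complex_normed_vector)"
  using bounded_linear.linear[OF bounded_linear_scaleC] by (rule linear_diff)

lemma scaleC_zero_right: "c *\<^sub>C (0::'a::complex_normed_vector) = 0"
  using bounded_linear.linear[OF bounded_linear_scaleC] by (rule linear_0)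

lemma onorm_scaleC:
  assumes "bounded_linear (f :: 'a::real_normed_vector \<Rightarrow> 'b::complex_normed_vector)"
  shows "onorm (\<lambda>x. c *\<^sub>C f x) = cmod c * onorm f"
proof -
  have le: "onorm (\<lambda>x. a *\<^sub>C g x) \<le> cmod a * onorm g"
    if "bounded_linear g" for a and g :: "'a \<Rightarrow> 'b"
    by (rule onorm_bound)
      (auto simp: norm_scaleC mult.assoc onorm[OF that] onorm_pos_le[OF that] intro!: mult_left_mono)
  have lin: "bounded_linear (\<lambda>x. c *\<^sub>C f x)"
    by (rule bounded_linear_compose[OF bounded_linear_scaleC assms])
  show ?thesis
  proof (cases "c = 0")
    case True
    then have "(\<lambda>x. c *\<^sub>C f x) = (\<lambda>x. 0)"
      using scaleC_of_real[of 0] by auto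
    then show ?thesis using True by (simp add: onorm_zero)
  next
    case False
    have one: "1 *\<^sub>C y = y" for y :: 'b
      using scaleC_of_real[of 1 y] by simp
    have "onorm f = onorm (\<lambda>x. inverse c *\<^sub>C (c *\<^sub>C f x))"
      using False by (simp add: scaleC_scaleC one)
    also have "\<dots> \<le> cmod (inverse c) * onorm (\<lambda>x. c *\<^sub>C f x)"
      by (rule le[OF lin])
    finally have "cmod c * onorm f \<le> cmod c * (cmod (inverse c) * onorm (\<lambda>x. c *\<^sub>C f x))"
      by (rule mult_left_mono) simp
    then have "cmod c * onorm f \<le> onorm (\<lambda>x. c *\<^sub>C f x)"
      using False by (simp add: norm_inverse mult.assoc[symmetric])
    with le[OF assms, of c] show ?thesis by linarith
  qed
qed

typedef (overloaded) ('a, 'b) cblinfun (\<open>(_ \<Rightarrow>\<^sub>C\<^sub>L /_)\<close> [22, 21] 21) =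
  "{f :: 'a::complex_normed_vector \<Rightarrow> 'b::complex_normed_vector.
      bounded_linear f \<and> (\<forall>c x. f (c *\<^sub>C x) = c *\<^sub>C f x)}"
  morphisms cblinfun_apply CBlinfun
  by (rule exI[of _ "\<lambda>x. 0"]) (simp add: scaleC_zero_right)

setup_lifting type_definition_cblinfun

lemma cblinfun_eqI: "(\<And>x. cblinfun_apply f x = cblinfun_apply g x) \<Longrightarrow> f = g"
  by transfer auto

instantiation cblinfun :: (complex_normed_vector, complex_normed_vector) complex_normed_vector
begin

lift_definition norm_cblinfun :: "'a \<Rightarrow>\<^sub>C\<^sub>L 'b \<Rightarrow> real" is onorm .

lift_definition minus_cblinfun :: "'a \<Rightarrow>\<^sub>C\<^sub>L 'b \<Rightarrow> 'a \<Rightarrow>\<^sub>C\<^sub>L 'b \<Rightarrow> 'a \<Rightarrow>\<^sub>C\<^sub>L 'b"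
  is "\<lambda>f g x. f x - g x"
  by (simp add: bounded_linear_sub scaleC_diff_right)

definition dist_cblinfun :: "'a \<Rightarrow>\<^sub>C\<^sub>L 'b \<Rightarrow> 'a \<Rightarrow>\<^sub>C\<^sub>L 'b \<Rightarrow> real"
  where "dist_cblinfun a b = norm (a - b)"

definition uniformity_cblinfun :: "(('a \<Rightarrow>\<^sub>C\<^sub>L 'b) \<times> ('a \<Rightarrow>\<^sub>C\<^sub>L 'b)) filter"
  where [code del]: "uniformity_cblinfun = (INF e\<in>{0 <..}. principal {(x, y). dist x y < e})"

definition open_cblinfun :: "('a \<Rightarrow>\<^sub>C\<^sub>L 'b) set \<Rightarrow> bool"
  where [code del]: "open_cblinfun S = (\<forall>x\<in>S. \<forall>\<^sub>F (x', y) in uniformity. x' = x \<longrightarrow> y \<in> S)"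

lift_definition uminus_cblinfun :: "'a \<Rightarrow>\<^sub>C\<^sub>L 'b \<Rightarrow> 'a \<Rightarrow>\<^sub>C\<^sub>L 'b" is "\<lambda>f x. - f x"
  by (simp add: bounded_linear_minus scaleC_minus_right)

lift_definition zero_cblinfun :: "'a \<Rightarrow>\<^sub>C\<^sub>L 'b" is "\<lambda>x. 0"
  by (simp add: scaleC_zero_right)

lift_definition plus_cblinfun :: "'a \<Rightarrow>\<^sub>C\<^sub>L 'b \<Rightarrow> 'a \<Rightarrow>\<^sub>C\<^sub>L 'b \<Rightarrow> 'a \<Rightarrow>\<^sub>C\<^sub>L 'b"
  is "\<lambda>f g x. f x + g x"
  by (simp add: bounded_linear_add scaleC_add_right)

lift_definition scaleR_cblinfun :: "real \<Rightarrow> 'a \<Rightarrow>\<^sub>C\<^sub>L 'b \<Rightarrow> 'a \<Rightarrow>\<^sub>C\<^sub>L 'b" is "\<lambda>r f x. r *\<^sub>R f x"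
  by (auto simp: scaleC_scaleR intro: bounded_linear_compose[OF bounded_linear_scaleR_right])

lift_definition scaleC_cblinfun :: "complex \<Rightarrow> 'a \<Rightarrow>\<^sub>C\<^sub>L 'b \<Rightarrow> 'a \<Rightarrow>\<^sub>C\<^sub>L 'b" is "\<lambda>c f x. c *\<^sub>C f x"
  by (auto simp: scaleC_scaleC mult.commute intro: bounded_linear_compose[OF bounded_linear_scaleC])

definition sgn_cblinfun :: "'a \<Rightarrow>\<^sub>C\<^sub>L 'b \<Rightarrow> 'a \<Rightarrow>\<^sub>C\<^sub>L 'b"
  where "sgn_cblinfun x = scaleR (inverse (norm x)) x"

instance
  apply standard
  unfolding dist_cblinfun_def open_cblinfun_def sgn_cblinfun_def uniformity_cblinfun_def
  apply (rule refl | (transfer, force simp: onorm_triangle onorm_scaleR onorm_eq_0 algebra_simps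
      scaleC_add_right scaleC_add_left scaleC_scaleC scaleC_of_real onorm_scaleC))+
  done

end


section \<open>Real scalars\<close>

lift_definition canonical_embedding :: "'a::real_normed_vector \<Rightarrow> (('a \<Rightarrow>\<^sub>L real) \<Rightarrow>\<^sub>L real)"
  is "\<lambda>x f. blinfun_apply f x"
  by (intro bounded_linear_intros)

lift_definition adjoint_op ::
  "('a::real_normed_vector \<Rightarrow>\<^sub>L 'b::real_normed_vector) \<Rightarrow> (('b \<Rightarrow>\<^sub>L real) \<Rightarrow>\<^sub>L ('a \<Rightarrow>\<^sub>L real))"
  is "\<lambda>T f. f o\<^sub>L T"
  by (rule bounded_bilinear.bounded_linear_left[OF bounded_bilinear_blinfun_compose])

definition NA :: "('a::real_normed_vector \<Rightarrow>\<^sub>L 'b::real_normed_vector) set"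
  where "NA = {R. \<exists>e\<in>cball 0 1. norm (blinfun_apply R e) = norm R}"

text \<open>
  For scalar-valued operators the strong operator topology is the topology of pointwise
  convergence, that is, the weak-star topology \<open>\<sigma>(Z\<^sup>*, Z)\<close>.
\<close>

definition weak_star_QNA :: "('a::real_normed_vector \<Rightarrow>\<^sub>L ('z::real_normed_vector \<Rightarrow>\<^sub>L real)) set"
  where "weak_star_QNA =
    {T. (strong_operator_topology closure_of (blinfun_apply T ` cball 0 1)) \<inter> {u. norm u = norm T} \<noteq> {}}"


section \<open>Complex scalars\<close>

lemma bounded_linear_cblinfun_apply: "bounded_linear (cblinfun_apply f)"
  by transfer simp

lemma cblinfun_apply_scaleC: "cblinfun_apply f (c *\<^sub>C x) = c *\<^sub>C cblinfun_apply f x"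
  by transfer simp

lemma norm_cblinfun_apply: "norm (cblinfun_apply f x) \<le> norm f * norm x"
  by transfer (simp add: onorm)

lemma norm_cblinfun_bound:
  "0 \<le> b \<Longrightarrow> (\<And>x. norm (cblinfun_apply f x) \<le> b * norm x) \<Longrightarrow> norm f \<le> b"
  by transfer (rule onorm_bound)

lift_definition ccanonical_embedding ::
  "'a::complex_normed_vector \<Rightarrow> (('a \<Rightarrow>\<^sub>C\<^sub>L complex) \<Rightarrow>\<^sub>C\<^sub>L complex)"
  is "\<lambda>x f. cblinfun_apply f x"
  by (auto intro!: bounded_linear_intro norm_cblinfun_apply
      simp: plus_cblinfun.rep_eq scaleR_cblinfun.rep_eq scaleC_cblinfun.rep_eq)

lift_definition cblinfun_compose ::
  "('b::complex_normed_vector \<Rightarrow>\<^sub>C\<^sub>L 'c::complex_normed_vector) \<Rightarrow>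
    ('a::complex_normed_vector \<Rightarrow>\<^sub>C\<^sub>L 'b) \<Rightarrow> ('a \<Rightarrow>\<^sub>C\<^sub>L 'c)" (infixl \<open>o\<^sub>C\<^sub>L\<close> 55) is "(o)"
  by (auto simp: o_def intro: bounded_linear_compose)

lift_definition cadjoint_op ::
  "('a::complex_normed_vector \<Rightarrow>\<^sub>C\<^sub>L 'b::complex_normed_vector) \<Rightarrow>
    (('b \<Rightarrow>\<^sub>C\<^sub>L complex) \<Rightarrow>\<^sub>C\<^sub>L ('a \<Rightarrow>\<^sub>C\<^sub>L complex))"
  is "\<lambda>T f. f o\<^sub>C\<^sub>L T"
proof (intro conjI allI)
  fix T :: "'a \<Rightarrow>\<^sub>C\<^sub>L 'b"
  have "norm (f o\<^sub>C\<^sub>L T) \<le> norm f * norm T" for f :: "'b \<Rightarrow>\<^sub>C\<^sub>L complex"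
  proof (rule norm_cblinfun_bound)
    show "0 \<le> norm f * norm T" by simp
    fix x
    have "norm (cblinfun_apply f (cblinfun_apply T x)) \<le> norm f * norm (cblinfun_apply T x)"
      by (rule norm_cblinfun_apply)
    also have "\<dots> \<le> norm f * (norm T * norm x)"
      by (intro mult_left_mono norm_cblinfun_apply norm_ge_zero)
    finally show "norm (cblinfun_apply (f o\<^sub>C\<^sub>L T) x) \<le> norm f * norm T * norm x"
      by (simp add: cblinfun_compose.rep_eq mult.assoc)
  qed
  then show "bounded_linear (\<lambda>f :: 'b \<Rightarrow>\<^sub>C\<^sub>L complex. f o\<^sub>C\<^sub>L T)"
    by (intro bounded_linear_intro)
      (auto intro!: cblinfun_eqI
        simp: cblinfun_compose.rep_eq plus_cblinfun.rep_eq scaleR_cblinfun.rep_eq)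
  show "(c *\<^sub>C f) o\<^sub>C\<^sub>L T = c *\<^sub>C (f o\<^sub>C\<^sub>L T)" for c and f :: "'b \<Rightarrow>\<^sub>C\<^sub>L complex"
    by (auto intro!: cblinfun_eqI simp: cblinfun_compose.rep_eq scaleC_cblinfun.rep_eq)
qed

definition cNA :: "('a::complex_normed_vector \<Rightarrow>\<^sub>C\<^sub>L 'b::complex_normed_vector) set"
  where "cNA = {R. \<exists>e\<in>cball 0 1. norm (cblinfun_apply R e) = norm R}"

text \<open>The function space carries the product topology, so this is pointwise convergence.\<close>

definition cweak_star_topology :: "('z::complex_normed_vector \<Rightarrow>\<^sub>C\<^sub>L complex) topology"
  where "cweak_star_topology = pullback_topology UNIV cblinfun_apply euclidean"

definition cweak_star_QNA ::
  "('a::complex_normed_vector \<Rightarrow>\<^sub>C\<^sub>L ('z::complex_normed_vector \<Rightarrow>\<^sub>C\<^sub>L complex)) set"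
  where "cweak_star_QNA =
    {T. (cweak_star_topology closure_of (cblinfun_apply T ` cball 0 1)) \<inter> {u. norm u = norm T} \<noteq> {}}"

end

theory Submission
  imports Defs
begin

text \<open>
  Let \<open>\<phi>\<close> be a functional in the unit ball of \<open>Y\<^sup>*\<^sup>*\<^sup>*\<close> at which \<open>T\<^sup>*\<close> attains its norm, and let
  \<open>g\<close> be its restriction to \<open>Y\<close>, an element of the unit ball of \<open>Y\<^sup>*\<close>.  Since \<open>T\<close> takes values
  in \<open>Y\<close>, \<open>T\<^sup>*\<phi>\<close> is the functional \<open>x \<mapsto> T x g\<close>, so \<open>\<bar>T x g\<bar>\<close> comes arbitrarily close
  to \<open>\<parallel>T\<parallel>\<close> on the unit ball of \<open>X\<close>.  By Tychonoff's theorem the pointwise closure of the image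
  of the unit ball is compact, so \<open>u \<mapsto> \<bar>u g\<bar>\<close> attains its maximum on it, and the maximizer
  has norm \<open>\<parallel>T\<parallel>\<close>.
\<close>

section \<open>Operator norms and pointwise limits of linear maps\<close>

text \<open>Homogeneity: a nonzero \<open>x\<close> is rescaled to the unit vector
  \<open>x /\<^sub>R norm x\<close>, and \<open>x = 0\<close> gives
  \<open>0 \<le> b\<close>.\<close>

lemma onorm_le_unit_ball:
  fixes f :: "'a::real_normed_vector \<Rightarrow> 'b::real_normed_vector"
  assumes "linear f" and bound: "\<And>x. x \<in> cball 0 1 \<Longrightarrow> norm (f x) \<le> b"
  shows "onorm f \<le> b"
proof (rule onorm_bound)
  interpret linear f by fact
  show "0 \<le> b"
    using bound[of 0] by (simp add: zero)
  fix x
  show "norm (f x) \<le> b * norm x"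
  proof (cases "x = 0")
    case True
    then show ?thesis by (simp add: zero)
  next
    case False
    then show ?thesis
      using bound[of "x /\<^sub>R norm x"] by (simp add: scale field_simps)
  qed
qed

lemma compact_PiE_UNIV:
  fixes S :: "'i \<Rightarrow> 'a::topological_space set"
  assumes "\<And>i. compact (S i)"
  shows "compact (PiE UNIV S)"
  using compactin_PiE[of "\<lambda>_. euclidean" UNIV S] assms
  by (simp add: euclidean_product_topology)

text \<open>Each condition compares values at finitely many points, and evaluations are continuous
  for pointwise convergence. Hence linearity and the bound by \<open>M\<close> pass to pointwise
  limits.\<close>

lemma closed_bounded_linear_le:
  "closed {f :: 'a::real_normed_vector \<Rightarrow> 'b::real_normed_vector.
     linear f \<and> (\<forall>x. norm (f x) \<le> M * norm x)}"
  unfolding linear_iff Collect_conj_eq Collect_all_eq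
  by (intro closed_Int closed_INT ballI closed_Collect_eq closed_Collect_le continuous_intros
      continuous_on_product_coordinates)

text \<open>The closure is a closed subset of the product of the balls of radius
  \<open>M * norm x\<close>, which are compact by the Heine-Borel property of the codomain. The
  lemma speaks of plain functions and real linearity so that it serves both scalar fields.\<close>

lemma pointwise_closure_attains_bound:
  fixes A :: "('a::real_normed_vector \<Rightarrow> 'b::{real_normed_vector, heine_borel}) set"
  assumes "A \<noteq> {}" and A: "\<And>f. f \<in> A \<Longrightarrow> linear f \<and> (\<forall>x. norm (f x) \<le> M * norm x)"
  obtains u where "u \<in> closure A" "bounded_linear u" "\<And>x. norm (u x) \<le> M * norm x"
    "\<And>f. f \<in> A \<Longrightarrow> norm (f a) \<le> norm (u a)"
proof -
  have sub: "closure A \<subseteq> {f. linear f \<and> (\<forall>x. norm (f x) \<le> M * norm x)}"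
    by (rule closure_minimal[OF _ closed_bounded_linear_le]) (use A in blast)
  then have "closure A \<subseteq> PiE UNIV (\<lambda>x. cball 0 (M * norm x))"
    by auto
  moreover have "compact (PiE UNIV (\<lambda>x::'a. cball (0::'b) (M * norm x)) \<inter> closure A)"
    by (intro compact_Int_closed compact_PiE_UNIV compact_cball closed_closure)
  ultimately have "compact (closure A)"
    by (simp add: Int_absorb1)
  moreover have "continuous_on (closure A) (\<lambda>f. norm (f a))"
    by (intro continuous_on_norm continuous_on_subset[OF continuous_on_product_coordinates]) auto
  ultimately obtain u where u: "u \<in> closure A" "\<And>f. f \<in> closure A \<Longrightarrow> norm (f a) \<le> norm (u a)"
    using continuous_attains_sup[of "closure A" "\<lambda>f. norm (f a)"] \<open>A \<noteq> {}\<close> by auto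
  have "linear u" and le: "\<And>x. norm (u x) \<le> M * norm x"
    using sub u(1) by auto
  then have "bounded_linear u"
    by (intro bounded_linear_intro[where K = M]) (auto simp: linear_add linear_scale mult.commute)
  with u le show thesis
    using closure_subset by (intro that[of u]) auto
qed

text \<open>Open sets of the pullback are preimages of open sets. This carries a limit found among
  plain functions back to the weak-star topology on operators.\<close>

lemma in_closure_of_pullback_UNIV:
  assumes "f u \<in> closure (f ` A)"
  shows "u \<in> pullback_topology UNIV f euclidean closure_of A"
proof -
  have "\<exists>y\<in>A. y \<in> W"
    if "u \<in> W" and W: "openin (pullback_topology UNIV f euclidean) W" for W
  proof -
    obtain U where U: "open U" "W = f -` U"
      using W by (auto simp: openin_pullback_topology)
    then have "U \<inter> f ` A \<noteq> {}"
      using assms \<open>u \<in> W\<close> open_Int_closure_eq_empty[of U "f ` A"] by blast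
    then show ?thesis
      using U by blast
  qed
  then show ?thesis
    by (auto simp: in_closure_of topspace_pullback_topology)
qed

section \<open>Real scalars\<close>

lemma norm_canonical_embedding_le: "norm (canonical_embedding x) \<le> norm x"
  by (rule norm_blinfun_bound)
    (simp_all add: canonical_embedding.rep_eq, metis mult.commute norm_blinfun real_norm_def)

text \<open>The values of \<open>T\<close> are functionals on \<open>'z\<close>, so its norm is
  tested on vectors \<open>z\<close>, where \<open>T x z\<close> is the adjoint at the canonical
  image of \<open>z\<close>, evaluated at \<open>x\<close>.\<close>

lemma norm_le_norm_adjoint_op:
  fixes T :: "'x::real_normed_vector \<Rightarrow>\<^sub>L ('z::real_normed_vector \<Rightarrow>\<^sub>L real)"
  shows "norm T \<le> norm (adjoint_op T)"
proof (intro norm_blinfun_bound norm_ge_zero mult_nonneg_nonneg)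
  fix x :: 'x and z :: 'z
  have "norm (T x z) = norm (adjoint_op T (canonical_embedding z) x)"
    by (simp add: adjoint_op.rep_eq canonical_embedding.rep_eq)
  also have "\<dots> \<le> norm (adjoint_op T (canonical_embedding z)) * norm x"
    by (rule norm_blinfun)
  also have "\<dots> \<le> (norm (adjoint_op T) * norm (canonical_embedding z)) * norm x"
    by (intro mult_right_mono norm_blinfun norm_ge_zero)
  also have "\<dots> \<le> (norm (adjoint_op T) * norm z) * norm x"
    by (intro mult_right_mono mult_left_mono norm_canonical_embedding_le norm_ge_zero)
  finally show "norm (T x z) \<le> norm (adjoint_op T) * norm x * norm z"
    by (simp add: mult_ac)
qed

text \<open>Limits of the image of the ball have norm at most \<open>norm T\<close>; one that
  maximizes the modulus at \<open>z\<close> has norm at least \<open>norm T\<close>, because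
  \<open>norm z \<le> 1\<close>.\<close>

lemma weak_star_QNA_if_norm_le_onorm:
  fixes T :: "'x::real_normed_vector \<Rightarrow>\<^sub>L ('z::real_normed_vector \<Rightarrow>\<^sub>L real)"
  assumes z: "norm z \<le> 1" and T: "norm T \<le> onorm (\<lambda>x. T x z)"
  shows "T \<in> weak_star_QNA"
proof -
  have bound: "norm (T x w) \<le> norm T * norm w" if "x \<in> cball 0 1" for x w
  proof -
    have "norm (T x) \<le> norm T * 1"
      using that by (intro order_trans[OF norm_blinfun[of T x]] mult_left_mono) auto
    then show ?thesis
      by (intro order_trans[OF norm_blinfun[of "T x" w]] mult_right_mono) auto
  qed
  obtain f where f: "f \<in> closure (blinfun_apply ` (T ` cball 0 1))" "bounded_linear f"
      "\<And>w. norm (f w) \<le> norm T * norm w"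
      "\<And>h. h \<in> blinfun_apply ` (T ` cball 0 1) \<Longrightarrow> norm (h z) \<le> norm (f z)"
    by (rule pointwise_closure_attains_bound
          [where A = "blinfun_apply ` (T ` cball 0 1)" and M = "norm T" and a = z])
      (use bound in \<open>auto simp: blinfun.bounded_linear_right bounded_linear.linear\<close>)
  \<comment> \<open>The limit \<open>f\<close> is so far only a function; its bounded linearity
    makes it an element of the dual.\<close>
  define u where "u = Blinfun f"
  have u: "blinfun_apply u = f"
    using f(2) by (simp add: u_def bounded_linear_Blinfun_apply)
  have "u \<in> strong_operator_topology closure_of (T ` cball 0 1)"
    unfolding strong_operator_topology_def using f(1) u by (intro in_closure_of_pullback_UNIV) simp
  moreover have "norm u = norm T"
  proof (rule antisym)
    show "norm u \<le> norm T"
      using f(3) by (intro norm_blinfun_bound) (auto simp: u)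
    have "norm T \<le> onorm (\<lambda>x. T x z)"
      by (rule T)
    also have "\<dots> \<le> norm (u z)"
      using f(4) by (intro onorm_le_unit_ball) (auto simp: u linear_iff blinfun.bilinear_simps)
    also have "\<dots> \<le> norm u * norm z"
      by (rule norm_blinfun)
    also have "\<dots> \<le> norm u"
      using z by (simp add: mult_left_le)
    finally show "norm T \<le> norm u" .
  qed
  ultimately show ?thesis
    by (auto simp: weak_star_QNA_def)
qed

lemma weak_star_QNA_if_adjoint_NA:
  fixes T :: "'x::real_normed_vector \<Rightarrow>\<^sub>L (('y::real_normed_vector \<Rightarrow>\<^sub>L real) \<Rightarrow>\<^sub>L real)"
  assumes T: "range T \<subseteq> range (canonical_embedding :: 'y \<Rightarrow> _)" and "adjoint_op T \<in> NA"
  shows "T \<in> weak_star_QNA"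
proof -
  obtain \<phi> where \<phi>: "norm \<phi> \<le> 1" "norm (adjoint_op T \<phi>) = norm (adjoint_op T)"
    using assms(2) by (auto simp: NA_def)
  have le: "norm (\<phi> (canonical_embedding y)) \<le> 1 * norm y" for y :: 'y
    using \<phi>(1) by (intro order_trans[OF norm_blinfun] mult_mono norm_canonical_embedding_le) auto
  have add: "canonical_embedding (x + y) = canonical_embedding x + canonical_embedding y"
    and scale: "canonical_embedding (r *\<^sub>R x) = r *\<^sub>R canonical_embedding x" for x y :: 'y and r
    by (auto intro!: blinfun_eqI simp: canonical_embedding.rep_eq blinfun.bilinear_simps)
  have "bounded_linear (\<lambda>y::'y. \<phi> (canonical_embedding y))"
    using le by (intro bounded_linear_intro[where K = 1])
      (auto simp: add scale blinfun.bilinear_simps mult.commute)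
  \<comment> \<open>\<open>g\<close> is the restriction of \<open>\<phi>\<close> to the canonical
    image of \<open>'y\<close>.\<close>
  then obtain g :: "'y \<Rightarrow>\<^sub>L real" where g: "\<And>y. g y = \<phi> (canonical_embedding y)"
    by (metis bounded_linear_Blinfun_apply)
  \<comment> \<open>If \<open>T x\<close> is the canonical image of \<open>y\<close>, both sides
    equal \<open>\<phi> (canonical_embedding y)\<close>, that is \<open>g y\<close>.\<close>
  have "blinfun_apply (adjoint_op T \<phi>) = (\<lambda>x. T x g)"
  proof
    fix x
    obtain y where "T x = canonical_embedding y"
      using T by blast
    then show "adjoint_op T \<phi> x = T x g"
      by (simp add: adjoint_op.rep_eq g canonical_embedding.rep_eq)
  qed
  \<comment> \<open>Attainment at \<open>\<phi>\<close> replaces the norm of the adjoint by the norm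
    of a single functional on \<open>'x\<close>.\<close>
  then have "norm (adjoint_op T) = onorm (\<lambda>x. T x g)"
    unfolding \<phi>(2)[symmetric] unfolding norm_blinfun.rep_eq by simp
  moreover have "norm g \<le> 1"
    using le by (intro norm_blinfun_bound) (auto simp: g)
  ultimately show ?thesis
    using norm_le_norm_adjoint_op[of T] by (intro weak_star_QNA_if_norm_le_onorm[of g]) auto
qed

section \<open>Complex scalars\<close>

lemma norm_ccanonical_embedding_le: "norm (ccanonical_embedding x) \<le> norm x"
  by (rule norm_cblinfun_bound)
    (simp_all add: ccanonical_embedding.rep_eq, metis mult.commute norm_cblinfun_apply)

lemma norm_le_norm_cadjoint_op:
  fixes T :: "'x::complex_normed_vector \<Rightarrow>\<^sub>C\<^sub>L ('z::complex_normed_vector \<Rightarrow>\<^sub>C\<^sub>L complex)"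
  shows "norm T \<le> norm (cadjoint_op T)"
proof (intro norm_cblinfun_bound norm_ge_zero mult_nonneg_nonneg)
  fix x :: 'x and z :: 'z
  let ?J = "ccanonical_embedding z"
  have "norm (cblinfun_apply (cblinfun_apply T x) z)
      = norm (cblinfun_apply (cblinfun_apply (cadjoint_op T) ?J) x)"
    by (simp add: cadjoint_op.rep_eq ccanonical_embedding.rep_eq cblinfun_compose.rep_eq)
  also have "\<dots> \<le> norm (cblinfun_apply (cadjoint_op T) ?J) * norm x"
    by (rule norm_cblinfun_apply)
  also have "\<dots> \<le> (norm (cadjoint_op T) * norm ?J) * norm x"
    by (intro mult_right_mono norm_cblinfun_apply norm_ge_zero)
  also have "\<dots> \<le> (norm (cadjoint_op T) * norm z) * norm x"
    by (intro mult_right_mono mult_left_mono norm_ccanonical_embedding_le norm_ge_zero)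
  finally show "norm (cblinfun_apply (cblinfun_apply T x) z)
      \<le> norm (cadjoint_op T) * norm x * norm z"
    by (simp add: mult_ac)
qed

text \<open>Supplies the complex homogeneity of pointwise limits, which the real-linear compactness
  argument leaves open.\<close>

lemma closed_complex_homogeneous:
  "closed {f :: 'a::complex_normed_vector \<Rightarrow> 'b::complex_normed_vector.
     \<forall>c x. f (c *\<^sub>C x) = c *\<^sub>C f x}"
  unfolding Collect_all_eq
  by (intro closed_INT ballI closed_Collect_eq continuous_on_product_coordinates
      bounded_linear.continuous_on[OF bounded_linear_scaleC])

lemma cweak_star_QNA_if_norm_le_onorm:
  fixes T :: "'x::complex_normed_vector \<Rightarrow>\<^sub>C\<^sub>L ('z::complex_normed_vector \<Rightarrow>\<^sub>C\<^sub>L complex)"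
  assumes z: "norm z \<le> 1" and T: "norm T \<le> onorm (\<lambda>x. cblinfun_apply (cblinfun_apply T x) z)"
  shows "T \<in> cweak_star_QNA"
proof -
  let ?A = "cblinfun_apply ` (cblinfun_apply T ` cball 0 1)"
  have bound: "norm (cblinfun_apply (cblinfun_apply T x) w) \<le> norm T * norm w"
    if "x \<in> cball 0 1" for x w
  proof -
    have "norm (cblinfun_apply T x) \<le> norm T * 1"
      using that by (intro order_trans[OF norm_cblinfun_apply[of T x]] mult_left_mono) auto
    then show ?thesis
      by (intro order_trans[OF norm_cblinfun_apply[of "cblinfun_apply T x" w]] mult_right_mono) auto
  qed
  obtain f where f: "f \<in> closure ?A" "bounded_linear f" "\<And>w. norm (f w) \<le> norm T * norm w"
      "\<And>h. h \<in> ?A \<Longrightarrow> norm (h z) \<le> norm (f z)"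
    by (rule pointwise_closure_attains_bound[where A = ?A and M = "norm T" and a = z])
      (use bound in \<open>auto simp: bounded_linear_cblinfun_apply bounded_linear.linear\<close>)
  \<comment> \<open>\<open>f\<close> is known to be real-linear only; as a pointwise limit of
    complex-linear functionals it is also complex homogeneous, so \<open>CBlinfun\<close> accepts
    it.\<close>
  have "closure ?A \<subseteq> {f. \<forall>c x. f (c *\<^sub>C x) = c *\<^sub>C f x}"
    by (rule closure_minimal[OF _ closed_complex_homogeneous]) (auto simp: cblinfun_apply_scaleC)
  define u where "u = CBlinfun f"
  have u: "cblinfun_apply u = f"
    using f(1,2) \<open>closure ?A \<subseteq> _\<close> by (auto simp: u_def intro!: CBlinfun_inverse)
  have "u \<in> cweak_star_topology closure_of (cblinfun_apply T ` cball 0 1)"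
    unfolding cweak_star_topology_def using f(1) u by (intro in_closure_of_pullback_UNIV) simp
  moreover have "norm u = norm T"
  proof (rule antisym)
    show "norm u \<le> norm T"
      using f(3) by (intro norm_cblinfun_bound) (auto simp: u)
    have lin: "linear (\<lambda>x. cblinfun_apply (cblinfun_apply T x) z)"
      by (simp add: linear_iff linear_add[OF bounded_linear.linear[OF bounded_linear_cblinfun_apply]]
          linear_scale[OF bounded_linear.linear[OF bounded_linear_cblinfun_apply]]
          plus_cblinfun.rep_eq scaleR_cblinfun.rep_eq)
    have "norm T \<le> onorm (\<lambda>x. cblinfun_apply (cblinfun_apply T x) z)"
      by (rule T)
    also have "\<dots> \<le> norm (cblinfun_apply u z)"
      using f(4) by (intro onorm_le_unit_ball lin) (auto simp: u)
    also have "\<dots> \<le> norm u * norm z"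
      by (rule norm_cblinfun_apply)
    also have "\<dots> \<le> norm u"
      using z by (simp add: mult_left_le)
    finally show "norm T \<le> norm u" .
  qed
  ultimately show ?thesis
    by (auto simp: cweak_star_QNA_def)
qed

lemma cweak_star_QNA_if_cadjoint_cNA:
  fixes T :: "'x::complex_normed_vector \<Rightarrow>\<^sub>C\<^sub>L
      (('y::complex_normed_vector \<Rightarrow>\<^sub>C\<^sub>L complex) \<Rightarrow>\<^sub>C\<^sub>L complex)"
  assumes T: "range (cblinfun_apply T) \<subseteq> range (ccanonical_embedding :: 'y \<Rightarrow> _)"
    and "cadjoint_op T \<in> cNA"
  shows "T \<in> cweak_star_QNA"
proof -
  obtain \<phi> where \<phi>: "norm \<phi> \<le> 1"
      "norm (cblinfun_apply (cadjoint_op T) \<phi>) = norm (cadjoint_op T)"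
    using assms(2) by (auto simp: cNA_def)
  have le: "norm (cblinfun_apply \<phi> (ccanonical_embedding y)) \<le> 1 * norm y" for y :: 'y
    using \<phi>(1)
    by (intro order_trans[OF norm_cblinfun_apply] mult_mono norm_ccanonical_embedding_le) auto
  interpret \<phi>: bounded_linear "cblinfun_apply \<phi>"
    by (rule bounded_linear_cblinfun_apply)
  have add: "ccanonical_embedding (x + y) = ccanonical_embedding x + ccanonical_embedding y"
    and scaleR: "ccanonical_embedding (r *\<^sub>R x) = r *\<^sub>R ccanonical_embedding x"
    and scaleC: "ccanonical_embedding (c *\<^sub>C x) = c *\<^sub>C ccanonical_embedding x"
    for x y :: 'y and r c
    by (auto intro!: cblinfun_eqI simp: ccanonical_embedding.rep_eq plus_cblinfun.rep_eq
        scaleR_cblinfun.rep_eq scaleC_cblinfun.rep_eq cblinfun_apply_scaleC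
        linear_add[OF bounded_linear.linear[OF bounded_linear_cblinfun_apply]]
        linear_scale[OF bounded_linear.linear[OF bounded_linear_cblinfun_apply]])
  have "bounded_linear (\<lambda>y::'y. cblinfun_apply \<phi> (ccanonical_embedding y))"
    using le by (intro bounded_linear_intro[where K = 1])
      (auto simp: add scaleR \<phi>.add \<phi>.scaleR mult.commute)
  \<comment> \<open>With real bounded linearity, this makes the restriction of \<open>\<phi>\<close>
    an element of the complex dual.\<close>
  moreover have "cblinfun_apply \<phi> (ccanonical_embedding (c *\<^sub>C y))
      = c *\<^sub>C cblinfun_apply \<phi> (ccanonical_embedding y)" for c and y :: 'y
    by (simp add: scaleC cblinfun_apply_scaleC)
  ultimately have "cblinfun_apply (CBlinfun (\<lambda>y::'y. cblinfun_apply \<phi> (ccanonical_embedding y)))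
      = (\<lambda>y. cblinfun_apply \<phi> (ccanonical_embedding y))"
    by (intro CBlinfun_inverse) simp
  then obtain g :: "'y \<Rightarrow>\<^sub>C\<^sub>L complex"
    where g: "cblinfun_apply g = (\<lambda>y. cblinfun_apply \<phi> (ccanonical_embedding y))"
    by blast
  have "cblinfun_apply (cblinfun_apply (cadjoint_op T) \<phi>)
      = (\<lambda>x. cblinfun_apply (cblinfun_apply T x) g)"
  proof
    fix x
    obtain y where "cblinfun_apply T x = ccanonical_embedding y"
      using T by blast
    then show "cblinfun_apply (cblinfun_apply (cadjoint_op T) \<phi>) x
        = cblinfun_apply (cblinfun_apply T x) g"
      by (simp add: cadjoint_op.rep_eq cblinfun_compose.rep_eq g ccanonical_embedding.rep_eq)
  qed
  then have "norm (cadjoint_op T) = onorm (\<lambda>x. cblinfun_apply (cblinfun_apply T x) g)"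
    unfolding \<phi>(2)[symmetric] unfolding norm_cblinfun.rep_eq by simp
  moreover have "norm g \<le> 1"
    using le by (intro norm_cblinfun_bound) (auto simp: g)
  ultimately show ?thesis
    using norm_le_norm_cadjoint_op[of T] by (intro cweak_star_QNA_if_norm_le_onorm[of g]) auto
qed

theorem proposition3p3:
  fixes T :: "'x::banach \<Rightarrow>\<^sub>L (('y::banach \<Rightarrow>\<^sub>L real) \<Rightarrow>\<^sub>L real)"
    and S :: "'u::{complex_normed_vector, banach} \<Rightarrow>\<^sub>C\<^sub>L
      (('v::{complex_normed_vector, banach} \<Rightarrow>\<^sub>C\<^sub>L complex) \<Rightarrow>\<^sub>C\<^sub>L complex)"
  shows "(range (blinfun_apply T) \<subseteq> range (canonical_embedding :: 'y \<Rightarrow> _) \<and> adjoint_op T \<in> NA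
            \<longrightarrow> T \<in> weak_star_QNA)
       \<and> (range (cblinfun_apply S) \<subseteq> range (ccanonical_embedding :: 'v \<Rightarrow> _) \<and> cadjoint_op S \<in> cNA
            \<longrightarrow> S \<in> cweak_star_QNA)"
  using weak_star_QNA_if_adjoint_NA[of T] cweak_star_QNA_if_cadjoint_cNA[of S] by blast

end
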